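(* Let $N$ be a positive integer. (1) For every oriented rank $2$ subgroup $\mathbb{L}\subset\mathbb{Z}^N$ which is not contained in any of the standard coordinate hyperplanes of $\mathbb{Z}^N$ and is perpendicular to $(1,\ldots,1)$, the Plücker quiver of $\mathbb{L}$ has no isolated nodes and no directed loops of length $\leq 2$, in every node the number of incoming arrows equals the number of outgoing arrows, and the rank of its anti-symmetrized adjacency matrix is $2$. (2) Conversely, every quiver with node set $\{1,\ldots,N\}$ which has no isolated nodes, no directed loops of length $\leq 2$, in which in every node the number of incoming arrows equals the number of outgoing arrows, and whose anti-symmetrized adjacency matrix has rank $2$, is the Plücker quiver of some oriented rank $2$ subgroup $\mathbb{L}\subset\mathbb{Z}^N$ which is not contained in any of the standard coordinate hyperplanes of $\mathbb{Z}^N$ and is perpendicular to $(1,\ldots,1)$. (3) The correspondence $\mathbb{L}\mapsto$ (Plücker quiver of $\mathbb{L}$) is one-to-one between those subgroups $\mathbb{L}$ as in (1) for which the quotient group $\mathbb{Z}^N/\mathbb{L}$ has no torsion and those quivers as in (2) for which the greatest common divisor of the entries of the anti-symmetrized adjacency matrix is $1$.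
   Context: The standard coordinate hyperplanes are $\{(z_1,\ldots,z_N):z_i=0\}$, $i=1,\ldots,N$. "Perpendicular to $(1,\ldots,1)$" means $\ell_1+\ldots+\ell_N=0$ for all $(\ell_1,\ldots,\ell_N)\in\mathbb{L}$. An orientation of $\mathbb{L}$ is a choice of one of the two isomorphisms $\bigwedge^2\mathbb{L}\simeq\mathbb{Z}$. Given an oriented $\mathbb{L}$, choose a $\mathbb{Z}$-basis of $\mathbb{L}$ compatible with the orientation, write the two basis vectors as the rows of a $2\times N$-matrix $B$ and let $\mathbf{b}_1,\ldots,\mathbf{b}_N$ be the columns of $B$. The matrix $(\det(\mathbf{b}_i,\mathbf{b}_j))_{1\leq i,j\leq N}$ does not depend on the choice of the oriented basis; it is called the matrix of the Plücker form of $\mathbb{L}$. A quiver is a finite directed graph (multiple arrows allowed). Its adjacency matrix is $(q_{ij})$, with $q_{ij}$ the number of arrows from node $i$ to node $j$, and its anti-symmetrized adjacency matrix is $Q=(q_{ij}-q_{ji})$. A quiver has no directed loops of length $\leq 2$ if $q_{ij}q_{ji}=0$ for all $i,j$; such a quiver is faithfully described by $Q$ (quivers with the same node set and the same adjacency matrix are identified). The Plücker quiver of $\mathbb{L}$ is the quiver with node set $\{1,\ldots,N\}$, without directed loops of length $\leq 2$, whose anti-symmetrized adjacency matrix equals the matrix of the Plücker form of $\mathbb{L}$. *)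

theory Defs
  imports
    "HOL-Analysis.Analysis"
    "HOL-Algebra.Free_Abelian_Groups"
    "HOL-Library.Multiset"
begin

(* The index set {1..N} is rendered as a finite type 'n with CARD('n) = N. *)

section \<open>Rank two subgroups of the integer lattice\<close>

definition lattice_group :: "(int ^ 'n) monoid" where
  "lattice_group = \<lparr>carrier = UNIV, monoid.mult = (+), one = 0\<rparr>"

definition coord_hyperplane :: "'n \<Rightarrow> (int ^ 'n) set" where
  "coord_hyperplane i = {z. z $ i = 0}"

(* c v* B is the integral combination of the rows of B with coefficients c. *)
definition is_lattice_basis :: "(int ^ 'n) set \<Rightarrow> int ^ 'n ^ 2 \<Rightarrow> bool" where
  "is_lattice_basis L B \<longleftrightarrow> bij_betw (\<lambda>c. c v* B) UNIV L"

definition rank_two_subgroup :: "(int ^ 'n) set \<Rightarrow> bool" where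
  "rank_two_subgroup L \<longleftrightarrow> subgroup L lattice_group \<and> (\<exists>B. is_lattice_basis L B)"

definition admissible :: "(int ^ 'n) set \<Rightarrow> bool" where
  "admissible L \<longleftrightarrow>
     rank_two_subgroup L \<and>
     (\<forall>i. \<not> L \<subseteq> coord_hyperplane i) \<and>
     (\<forall>l \<in> L. (\<Sum>i\<in>UNIV. l $ i) = 0)"

definition torsion_free :: "('a, 'm) monoid_scheme \<Rightarrow> bool" where
  "torsion_free G \<longleftrightarrow>
     (\<forall>x \<in> carrier G. \<forall>k::nat. k > 0 \<longrightarrow> x [^]\<^bsub>G\<^esub> k = \<one>\<^bsub>G\<^esub> \<longrightarrow> x = \<one>\<^bsub>G\<^esub>)"


section \<open>Orientations\<close>

(* The exterior square of the abelian group A: the free abelian group on the symbols (x, y),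
   modulo biadditivity and the relations (x, x) = 0.  Over the integers, homogeneity in each
   argument follows from biadditivity. *)

definition wedge_relations :: "'a::ab_group_add set \<Rightarrow> ('a \<times> 'a \<Rightarrow>\<^sub>0 int) set" where
  "wedge_relations A =
     {frag_of (x + y, z) - frag_of (x, z) - frag_of (y, z) | x y z. x \<in> A \<and> y \<in> A \<and> z \<in> A} \<union>
     {frag_of (x, y + z) - frag_of (x, y) - frag_of (x, z) | x y z. x \<in> A \<and> y \<in> A \<and> z \<in> A} \<union>
     {frag_of (x, x) | x. x \<in> A}"

definition wedge_kernel :: "'a::ab_group_add set \<Rightarrow> ('a \<times> 'a \<Rightarrow>\<^sub>0 int) set" where
  "wedge_kernel A = generate (free_Abelian_group (A \<times> A)) (wedge_relations A)"

definition exterior_square :: "'a::ab_group_add set \<Rightarrow> ('a \<times> 'a \<Rightarrow>\<^sub>0 int) set monoid" where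
  "exterior_square A = free_Abelian_group (A \<times> A) Mod wedge_kernel A"

definition wedge :: "'a::ab_group_add set \<Rightarrow> 'a \<Rightarrow> 'a \<Rightarrow> ('a \<times> 'a \<Rightarrow>\<^sub>0 int) set" where
  "wedge A x y = wedge_kernel A #>\<^bsub>free_Abelian_group (A \<times> A)\<^esub> frag_of (x, y)"

type_synonym 'n orientation = "((int ^ 'n) \<times> (int ^ 'n) \<Rightarrow>\<^sub>0 int) set \<Rightarrow> int"

(* The members of iso are total functions constrained on the carrier only; extensionality makes
   two orientations equal as soon as they agree as maps on the exterior square. *)
definition orientations :: "(int ^ 'n) set \<Rightarrow> 'n orientation set" where
  "orientations L =
     iso (exterior_square L) integer_group \<inter> extensional (carrier (exterior_square L))"

definition is_oriented_basis :: "(int ^ 'n) set \<Rightarrow> 'n orientation \<Rightarrow> int ^ 'n ^ 2 \<Rightarrow> bool" where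
  "is_oriented_basis L \<omega> B \<longleftrightarrow> is_lattice_basis L B \<and> \<omega> (wedge L (row 1 B) (row 2 B)) = 1"

definition column_det :: "int ^ 'n ^ 2 \<Rightarrow> 'n \<Rightarrow> 'n \<Rightarrow> int" where
  "column_det B i j = det (transpose (vector [column i B, column j B] :: int ^ 2 ^ 2))"

(* The matrix is the same for every oriented basis, so the choice is immaterial. *)
definition plucker_matrix :: "(int ^ 'n) set \<Rightarrow> 'n orientation \<Rightarrow> int ^ 'n ^ 'n" where
  "plucker_matrix L \<omega> = (let B = (SOME B. is_oriented_basis L \<omega> B) in \<chi> i j. column_det B i j)"


section \<open>Quivers\<close>

(* A quiver on the nodes 'n is its finite multiset of arrows (source, target); this identifies
   quivers with the same adjacency matrix. *)
type_synonym 'n quiver = "('n \<times> 'n) multiset"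

definition adjacency :: "'n quiver \<Rightarrow> nat ^ 'n ^ 'n" where
  "adjacency Q = (\<chi> i j. count Q (i, j))"

definition antisym_adjacency :: "'n quiver \<Rightarrow> int ^ 'n ^ 'n" where
  "antisym_adjacency Q = (\<chi> i j. int (adjacency Q $ i $ j) - int (adjacency Q $ j $ i))"

definition no_short_loops :: "'n::finite quiver \<Rightarrow> bool" where
  "no_short_loops Q \<longleftrightarrow> (\<forall>i j. adjacency Q $ i $ j * adjacency Q $ j $ i = 0)"

definition isolated_node :: "'n quiver \<Rightarrow> 'n \<Rightarrow> bool" where
  "isolated_node Q i \<longleftrightarrow> (\<forall>a \<in># Q. fst a \<noteq> i \<and> snd a \<noteq> i)"

definition incoming :: "'n quiver \<Rightarrow> 'n \<Rightarrow> nat" where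
  "incoming Q i = size {#a \<in># Q. snd a = i#}"

definition outgoing :: "'n quiver \<Rightarrow> 'n \<Rightarrow> nat" where
  "outgoing Q i = size {#a \<in># Q. fst a = i#}"

definition antisym_rank :: "'n::finite quiver \<Rightarrow> nat" where
  "antisym_rank Q = rank (map_matrix real_of_int (antisym_adjacency Q))"

definition good_quiver :: "'n::finite quiver \<Rightarrow> bool" where
  "good_quiver Q \<longleftrightarrow>
     (\<forall>i. \<not> isolated_node Q i) \<and>
     no_short_loops Q \<and>
     (\<forall>i. incoming Q i = outgoing Q i) \<and>
     antisym_rank Q = 2"

definition entries_gcd :: "'n::finite quiver \<Rightarrow> int" where
  "entries_gcd Q = Gcd {antisym_adjacency Q $ i $ j | i j. True}"

definition plucker_quiver :: "(int ^ 'n) set \<Rightarrow> 'n orientation \<Rightarrow> 'n quiver" where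
  "plucker_quiver L \<omega> =
     (THE Q. no_short_loops Q \<and> antisym_adjacency Q = plucker_matrix L \<omega>)"

end

theory Submission
  imports Defs
begin

text \<open>
  Everything passes through the antisymmetric matrix \<open>plucker a b\<close> with entries
  \<open>a\<^sub>i b\<^sub>j - a\<^sub>j b\<^sub>i\<close>. It is bilinear and alternating in \<open>(a, b)\<close>, so a change of basis of the
  lattice multiplies it by a determinant (lemma \<open>plucker_combination\<close>), and it is nonzero
  exactly when \<open>a\<close> and \<open>b\<close> are independent.

  An orientation \<open>\<omega>\<close> is an isomorphism from the exterior square to the integers. For a lattice
  with basis \<open>a, b\<close> the exterior square is cyclic on the class of \<open>a \<and> b\<close>, and every basis
  determines an orientation taking the value 1 there (lemmas \<open>exterior_square_cyclic\<close>
  and \<open>orientation_exists\<close>). So an orientation is a choice of sign, the matrix of the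
  Pluecker form is \<open>plucker a b\<close> for any basis of the right sign, and quivers without short
  loops are the same as antisymmetric integer matrices. Under this translation
  the absence of isolated nodes says that no row vanishes, and balancedness says that all row sums
  are zero.

  The first part is then linear algebra: row \<open>i\<close> of \<open>plucker a b\<close> is \<open>a\<^sub>i b - b\<^sub>i a\<close>, whence the row
  sums, the rank, and the vanishing of a row only if \<open>a\<^sub>i = b\<^sub>i = 0\<close>.

  For the converse, an antisymmetric matrix of rank 2 satisfies the three-term Pluecker relations
  (lemma \<open>relations_of_rank_two\<close>), and an antisymmetric integer matrix which satisfies them is
  \<open>plucker a b\<close> for explicit integer vectors \<open>a, b\<close>: one of its rows divided by its content, and
  the Bezout combination of its columns which realises that content (lemma
  \<open>decomposable\<close>). The two vectors inherit coordinate sum zero from the rows and columns, so they span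
  an admissible lattice. This works for any content of the matrix, and a common factor of all its
  entries becomes the index of the lattice in its saturation.

  Finally, the quotient of the integer lattice by \<open>L\<close> is torsion free if and only if the entries of the
  Pluecker matrix have greatest common divisor 1 (lemma \<open>saturated_iff_Gcd\<close>), and such a saturated
  \<open>L\<close> is recovered from the matrix as the set of all integer vectors \<open>x\<close> with \<open>x \<and> a \<and> b = 0\<close>
  (lemma \<open>saturated_lattice_span_eq\<close>). Since the matrix is nonzero it also fixes the sign \<open>\<omega>\<close>, which
  gives injectivity.
\<close>

section \<open>Lattices spanned by two vectors and their Pluecker matrix\<close>

definition lattice_span :: "int ^ 'n \<Rightarrow> int ^ 'n \<Rightarrow> (int ^ 'n) set" where
  "lattice_span a b = {s *s a + t *s b | s t. True}"

lemma lattice_spanI: "s *s a + t *s b \<in> lattice_span a b"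
  by (auto simp: lattice_span_def)

lemma generators_in_lattice_span: "a \<in> lattice_span a b" "b \<in> lattice_span a b"
  using lattice_spanI[of 1 a 0 b] lattice_spanI[of 0 a 1 b] by auto

lemma lattice_span_add:
  assumes "x \<in> lattice_span a b" "y \<in> lattice_span a b"
  shows "x + y \<in> lattice_span a b"
proof -
  obtain s t s' t' where "x = s *s a + t *s b" "y = s' *s a + t' *s b"
    using assms by (auto simp: lattice_span_def)
  then have "x + y = (s + s') *s a + (t + t') *s b"
    by (simp add: vec_eq_iff algebra_simps)
  then show ?thesis by (metis lattice_spanI)
qed

lemma lattice_span_scale:
  assumes "x \<in> lattice_span a b"
  shows "c *s x \<in> lattice_span a b"
proof -
  obtain s t where "x = s *s a + t *s b"
    using assms by (auto simp: lattice_span_def)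
  then have "c *s x = (c * s) *s a + (c * t) *s b"
    by (simp add: vec_eq_iff algebra_simps)
  then show ?thesis by (metis lattice_spanI)
qed

definition plucker :: "int ^ 'n \<Rightarrow> int ^ 'n \<Rightarrow> int ^ 'n ^ 'n" where
  "plucker a b = (\<chi> i j. a $ i * b $ j - a $ j * b $ i)"

lemma plucker_nth: "plucker a b $ i $ j = a $ i * b $ j - a $ j * b $ i"
  by (simp add: plucker_def)

text \<open>Over the columns, this is multiplicativity of \<open>2 \<times> 2\<close> determinants.\<close>
lemma plucker_combination:
  "plucker (s *s a + t *s b) (s' *s a + t' *s b) $ i $ j = (s * t' - t * s') * plucker a b $ i $ j"
  by (simp add: plucker_nth algebra_simps)

lemma plucker_nonzero_entry:
  assumes "plucker a b \<noteq> 0"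
  obtains i j where "plucker a b $ i $ j \<noteq> 0"
  using assms by (auto simp: vec_eq_iff)

section \<open>Wedge products in the exterior square\<close>

lemma free_Abelian_group_diff_closed:
  assumes "f \<in> carrier (free_Abelian_group S)" "g \<in> carrier (free_Abelian_group S)"
  shows "f - g \<in> carrier (free_Abelian_group S)"
  using assms keys_diff[of f g] by (auto simp only: carrier_free_Abelian_group_iff)

lemma wedge_relations_subset:
  fixes A :: "'a::ab_group_add set"
  assumes "\<And>x y. x \<in> A \<Longrightarrow> y \<in> A \<Longrightarrow> x + y \<in> A"
  shows "wedge_relations A \<subseteq> carrier (free_Abelian_group (A \<times> A))"
proof -
  have g: "frag_of (x, y) \<in> carrier (free_Abelian_group (A \<times> A))" if "x \<in> A" "y \<in> A" for x y
    using that by simp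
  show ?thesis
    unfolding wedge_relations_def
    by (intro Un_least subsetI; elim CollectE exE conjE; hypsubst;
        intro free_Abelian_group_diff_closed g assms; assumption)
qed

text \<open>
  Closure under addition puts the symbols \<open>(x + y, z)\<close> and \<open>(x, y + z)\<close> of the defining relations
  into the free abelian group on \<open>A \<times> A\<close>, so that the exterior square is a group.
\<close>
locale closed_under_add =
  fixes A :: "'a::ab_group_add set"
  assumes add_closed: "\<And>x y. x \<in> A \<Longrightarrow> y \<in> A \<Longrightarrow> x + y \<in> A"
begin

abbreviation F where "F \<equiv> free_Abelian_group (A \<times> A)"
abbreviation E where "E \<equiv> exterior_square A"

sublocale F: comm_group F
  by (rule abelian_free_Abelian_group)

lemma wedge_kernel_normal: "wedge_kernel A \<lhd> F"
  unfolding wedge_kernel_def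
  by (intro F.subgroup_imp_normal F.generate_is_subgroup wedge_relations_subset add_closed)

sublocale K: normal "wedge_kernel A" F
  by (rule wedge_kernel_normal)

sublocale E: comm_group E
  unfolding exterior_square_def using K.subgroup_axioms by (rule F.abelian_FactGroup)

lemma class_hom: "(#>\<^bsub>F\<^esub>) (wedge_kernel A) \<in> hom F E"
  unfolding exterior_square_def by (rule K.r_coset_hom_Mod)

sublocale quot: group_hom F E "(#>\<^bsub>F\<^esub>) (wedge_kernel A)"
  using class_hom by unfold_locales

lemma wedge_closed: "x \<in> A \<Longrightarrow> y \<in> A \<Longrightarrow> wedge A x y \<in> carrier E"
  unfolding wedge_def by (rule hom_in_carrier[OF class_hom]) simp

lemma frag_of_mem: "x \<in> A \<Longrightarrow> y \<in> A \<Longrightarrow> frag_of (x, y) \<in> carrier F"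
  by simp

lemma class_add:
  "f \<in> carrier F \<Longrightarrow> g \<in> carrier F \<Longrightarrow>
    wedge_kernel A #>\<^bsub>F\<^esub> (f + g) = (wedge_kernel A #>\<^bsub>F\<^esub> f) \<otimes>\<^bsub>E\<^esub> (wedge_kernel A #>\<^bsub>F\<^esub> g)"
  using hom_mult[OF class_hom, of f g] by simp

lemma class_eqI:
  assumes "f - g \<in> wedge_relations A" "g \<in> carrier F"
  shows "wedge_kernel A #>\<^bsub>F\<^esub> f = wedge_kernel A #>\<^bsub>F\<^esub> g"
proof -
  have "f - g \<in> wedge_kernel A"
    unfolding wedge_kernel_def using assms(1) by (rule generate.incl)
  then have "f \<in> wedge_kernel A #>\<^bsub>F\<^esub> g"
    unfolding r_coset_def by force
  then show ?thesis
    using F.repr_independence[of f "wedge_kernel A" g] assms(2) K.subgroup_axioms by simp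
qed

lemma wedge_add_left:
  assumes "x \<in> A" "y \<in> A" "z \<in> A"
  shows "wedge A (x + y) z = wedge A x z \<otimes>\<^bsub>E\<^esub> wedge A y z"
proof -
  have "wedge A (x + y) z = wedge_kernel A #>\<^bsub>F\<^esub> (frag_of (x, z) + frag_of (y, z))"
    unfolding wedge_def
  proof (rule class_eqI)
    show "frag_of (x + y, z) - (frag_of (x, z) + frag_of (y, z)) \<in> wedge_relations A"
      using assms unfolding wedge_relations_def diff_diff_eq[symmetric] by blast
    show "frag_of (x, z) + frag_of (y, z) \<in> carrier F"
      using assms F.m_closed[of "frag_of (x, z)" "frag_of (y, z)"] by simp
  qed
  then show ?thesis
    unfolding wedge_def using assms class_add[OF frag_of_mem frag_of_mem] by metis
qed

lemma wedge_add_right: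
  assumes "x \<in> A" "y \<in> A" "z \<in> A"
  shows "wedge A x (y + z) = wedge A x y \<otimes>\<^bsub>E\<^esub> wedge A x z"
proof -
  have "wedge A x (y + z) = wedge_kernel A #>\<^bsub>F\<^esub> (frag_of (x, y) + frag_of (x, z))"
    unfolding wedge_def
  proof (rule class_eqI)
    show "frag_of (x, y + z) - (frag_of (x, y) + frag_of (x, z)) \<in> wedge_relations A"
      using assms unfolding wedge_relations_def diff_diff_eq[symmetric] by blast
    show "frag_of (x, y) + frag_of (x, z) \<in> carrier F"
      using assms F.m_closed[of "frag_of (x, y)" "frag_of (x, z)"] by simp
  qed
  then show ?thesis
    unfolding wedge_def using assms class_add[OF frag_of_mem frag_of_mem] by metis
qed

lemma wedge_self:
  assumes "x \<in> A"
  shows "wedge A x x = \<one>\<^bsub>E\<^esub>"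
proof -
  have "wedge A x x = wedge_kernel A #>\<^bsub>F\<^esub> 0"
    unfolding wedge_def
  proof (rule class_eqI)
    show "frag_of (x, x) - 0 \<in> wedge_relations A"
      using assms unfolding wedge_relations_def by simp blast
  qed simp
  then show ?thesis
    using quot.hom_one by simp
qed

text \<open>Expand \<open>(y + x) \<and> (y + x) = 0\<close>.\<close>
lemma wedge_swap:
  assumes "x \<in> A" "y \<in> A"
  shows "wedge A y x = inv\<^bsub>E\<^esub> wedge A x y"
proof -
  have "\<one>\<^bsub>E\<^esub> = wedge A (y + x) (y + x)"
    using wedge_self assms add_closed by simp
  also have "\<dots> = wedge A y (y + x) \<otimes>\<^bsub>E\<^esub> wedge A x (y + x)"
    using assms add_closed by (intro wedge_add_left) auto
  also have "\<dots> = wedge A y x \<otimes>\<^bsub>E\<^esub> wedge A x y"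
    using assms by (simp add: wedge_add_right wedge_self wedge_closed)
  finally show ?thesis
    using assms by (intro E.inv_equality[symmetric]) (auto simp: wedge_closed)
qed

text \<open>
  The wedges are the images of the free generators, so a subgroup containing all of them is the whole
  exterior square.
\<close>
lemma generated_by_wedges:
  assumes S: "subgroup S E" and w: "\<And>x y. x \<in> A \<Longrightarrow> y \<in> A \<Longrightarrow> wedge A x y \<in> S"
  shows "S = carrier E"
proof
  show "S \<subseteq> carrier E" using S by (rule subgroup.subset)
  show "carrier E \<subseteq> S"
  proof
    fix X assume "X \<in> carrier E"
    then obtain f where f: "f \<in> carrier F" and X: "X = wedge_kernel A #>\<^bsub>F\<^esub> f"
      unfolding exterior_square_def carrier_FactGroup by auto
    have "Poly_Mapping.keys f \<subseteq> A \<times> A" using f by simp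
    then have "f \<in> carrier F \<and> wedge_kernel A #>\<^bsub>F\<^esub> f \<in> S"
    proof (induction f rule: frag_induction)
      case zero
      show ?case using subgroup.one_closed[OF S] quot.hom_one by simp
    next
      case (one p)
      then show ?case using w by (auto simp: wedge_def)
    next
      case (diff f g)
      then have f: "f \<in> carrier F" and g: "g \<in> carrier F" by auto
      then have n: "- g \<in> carrier F" by simp
      have "f - g = f + (- g)" by simp
      then have "f - g \<in> carrier F" using F.m_closed[OF f n] by simp
      moreover have "wedge_kernel A #>\<^bsub>F\<^esub> (f - g) =
          (wedge_kernel A #>\<^bsub>F\<^esub> f) \<otimes>\<^bsub>E\<^esub> inv\<^bsub>E\<^esub> (wedge_kernel A #>\<^bsub>F\<^esub> g)"
        using class_add[OF f n] quot.hom_inv[OF g] g by simp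
      ultimately show ?case
        using diff subgroup.m_closed[OF S] subgroup.m_inv_closed[OF S] by simp
    qed
    then show "X \<in> S" using X by simp
  qed
qed

end

section \<open>Orientations of a lattice with a basis\<close>

lemma closed_under_add_lattice_span: "closed_under_add (lattice_span a b)"
  by unfold_locales (rule lattice_span_add)

context
  fixes a b :: "int ^ 'n" and L
  assumes L: "L = lattice_span a b"
begin

interpretation closed_under_add L
  unfolding L by (rule closed_under_add_lattice_span)

lemma generators_mem: "a \<in> L" "b \<in> L"
  unfolding L by (rule generators_in_lattice_span)+

lemma wedge_generators_closed: "wedge L a b \<in> carrier (exterior_square L)"
  by (intro wedge_closed generators_mem)

lemma scale_mem: "x \<in> L \<Longrightarrow> c *s x \<in> L"
  unfolding L by (rule lattice_span_scale)

text \<open>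
  Additivity says that \<open>s \<mapsto> (s x) \<and> y\<close> is a homomorphism on the integers, and such a
  homomorphism is determined by its value at 1.
\<close>
lemma wedge_scale_left:
  assumes x: "x \<in> L" and y: "y \<in> L"
  shows "wedge L (s *s x) y = wedge L x y [^]\<^bsub>exterior_square L\<^esub> (s :: int)"
proof -
  have "(\<lambda>s. wedge L (s *s x) y) \<in> hom integer_group (exterior_square L)"
    using x y
    by (intro homI) (simp_all add: vector_sadd_rdistrib wedge_add_left wedge_closed scale_mem)
  from hom_int_pow[OF this, of 1 s] show ?thesis
    using E.is_group by simp
qed

lemma wedge_scale_right:
  assumes x: "x \<in> L" and y: "y \<in> L"
  shows "wedge L x (s *s y) = wedge L x y [^]\<^bsub>exterior_square L\<^esub> (s :: int)"
proof -
  have "(\<lambda>s. wedge L x (s *s y)) \<in> hom integer_group (exterior_square L)"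
    using x y
    by (intro homI) (simp_all add: vector_sadd_rdistrib wedge_add_right wedge_closed scale_mem)
  from hom_int_pow[OF this, of 1 s] show ?thesis
    using E.is_group by simp
qed

lemma wedge_combination:
  "wedge L (s *s a + t *s b) (s' *s a + t' *s b) =
     wedge L a b [^]\<^bsub>exterior_square L\<^esub> (s * t' - t * s' :: int)"
proof -
  have mem: "a \<in> L" "b \<in> L" "c *s a \<in> L" "c *s b \<in> L" "c *s a + d *s b \<in> L" for c d
    by (simp_all add: generators_mem scale_mem add_closed)
  note w = wedge_generators_closed
  have aa: "wedge L (s *s a) (s' *s a) = \<one>\<^bsub>exterior_square L\<^esub>"
    and bb: "wedge L (t *s b) (t' *s b) = \<one>\<^bsub>exterior_square L\<^esub>"
    using mem E.int_pow_one by (simp_all add: wedge_scale_left wedge_scale_right wedge_self)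
  have ab: "wedge L (s *s a) (t' *s b) = wedge L a b [^]\<^bsub>exterior_square L\<^esub> (s * t')"
    using mem w by (simp add: wedge_scale_left wedge_scale_right E.int_pow_pow)
  have "wedge L (t *s b) (s' *s a) = wedge L b a [^]\<^bsub>exterior_square L\<^esub> (t * s')"
    using mem wedge_closed by (simp add: wedge_scale_left wedge_scale_right E.int_pow_pow)
  also have "\<dots> = inv\<^bsub>exterior_square L\<^esub> (wedge L a b [^]\<^bsub>exterior_square L\<^esub> (t * s'))"
    using mem w by (simp add: wedge_swap[of a b] E.int_pow_inv)
  finally have ba: "wedge L (t *s b) (s' *s a) = \<dots>" .
  show ?thesis
    using mem w
    by (simp add: wedge_add_left wedge_add_right aa ab ba bb E.int_pow_diff E.m_comm)
qed

text \<open>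
  By bilinearity every wedge is a power of \<open>a \<and> b\<close>, and the wedges generate.
\<close>
lemma exterior_square_cyclic:
  assumes "X \<in> carrier (exterior_square L)"
  obtains n :: int where "X = wedge L a b [^]\<^bsub>exterior_square L\<^esub> n"
proof -
  let ?S = "generate (exterior_square L) {wedge L a b}"
  have S: "?S = {wedge L a b [^]\<^bsub>exterior_square L\<^esub> (n::int) | n. n \<in> UNIV}"
    by (rule E.generate_pow[OF wedge_generators_closed])
  have "?S = carrier (exterior_square L)"
  proof (rule generated_by_wedges)
    show "subgroup ?S (exterior_square L)"
      using wedge_generators_closed by (intro E.generate_is_subgroup) auto
    fix x y assume "x \<in> L" "y \<in> L"
    then show "wedge L x y \<in> ?S"
      unfolding S using wedge_combination unfolding L lattice_span_def by force
  qed
  then show ?thesis using that assms S by auto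
qed

lemma hom_exterior_square_wedge:
  assumes "h \<in> hom (exterior_square L) integer_group"
  shows "h (wedge L (s *s a + t *s b) (s' *s a + t' *s b)) = (s * t' - t * s') * h (wedge L a b)"
  unfolding wedge_combination
  using hom_int_pow[OF assms wedge_generators_closed] E.is_group by simp

lemma hom_exterior_square_eqI:
  assumes h: "h \<in> hom (exterior_square L) integer_group"
    and k: "k \<in> hom (exterior_square L) integer_group"
    and eq: "h (wedge L a b) = k (wedge L a b)"
    and X: "X \<in> carrier (exterior_square L)"
  shows "h X = k X"
proof -
  obtain n :: int where "X = wedge L a b [^]\<^bsub>exterior_square L\<^esub> n"
    using X by (rule exterior_square_cyclic)
  then show ?thesis
    using hom_int_pow[OF h wedge_generators_closed] hom_int_pow[OF k wedge_generators_closed]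
      eq E.is_group by simp
qed

lemma orientation_hom:
  "\<omega> \<in> orientations L \<Longrightarrow> \<omega> \<in> hom (exterior_square L) integer_group"
  by (simp add: orientations_def iso_def)

lemma orientation_eqI:
  assumes "\<omega> \<in> orientations L" "\<omega>' \<in> orientations L"
    and "\<omega> (wedge L a b) = \<omega>' (wedge L a b)"
  shows "\<omega> = \<omega>'"
proof (rule extensionalityI)
  show "\<omega> \<in> extensional (carrier (exterior_square L))" "\<omega>' \<in> extensional (carrier (exterior_square L))"
    using assms by (auto simp: orientations_def)
  show "\<omega> X = \<omega>' X" if "X \<in> carrier (exterior_square L)" for X
    using hom_exterior_square_eqI[OF orientation_hom orientation_hom] assms that by blast
qed

text \<open>
  Surjectivity yields an element of value 1; it is a power of \<open>a \<and> b\<close>, so the value of \<open>a \<and> b\<close>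
  divides 1.
\<close>
lemma orientation_of_basis:
  assumes "\<omega> \<in> orientations L"
  shows "\<bar>\<omega> (wedge L a b)\<bar> = 1"
proof -
  have "\<omega> ` carrier (exterior_square L) = UNIV"
    using assms by (auto simp: orientations_def iso_def bij_betw_def)
  then obtain X where X: "X \<in> carrier (exterior_square L)" "\<omega> X = 1" by (metis UNIV_I imageE)
  obtain n :: int where "X = wedge L a b [^]\<^bsub>exterior_square L\<^esub> n"
    using X(1) by (rule exterior_square_cyclic)
  then have "n * \<omega> (wedge L a b) = 1"
    using hom_int_pow[OF orientation_hom[OF assms] wedge_generators_closed] X(2) E.is_group by simp
  then show ?thesis by (simp add: zmult_eq_1_iff) fastforce
qed

text \<open>
  The determinant in the coordinates with respect to \<open>a, b\<close> is biadditive and alternating, hence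
  induces a homomorphism on the exterior square with value 1 at \<open>a \<and> b\<close>. Since \<open>a \<and> b\<close> generates the
  exterior square, this homomorphism is an isomorphism.
\<close>
lemma orientation_exists:
  assumes ab: "plucker a b \<noteq> 0"
  obtains \<omega> where "\<omega> \<in> orientations L" "\<omega> (wedge L a b) = 1"
proof -
  obtain i j where m: "plucker a b $ i $ j \<noteq> 0" using ab by (rule plucker_nonzero_entry)
  (* d (x, y) is the coordinate determinant of x and y: any nonzero entry of the Pluecker matrix
     computes it by exact division, without choosing coordinates. *)
  define d where "d = (\<lambda>(x, y). plucker x y $ i $ j div plucker a b $ i $ j)"
  have dvd: "plucker a b $ i $ j dvd plucker x y $ i $ j" if "x \<in> L" "y \<in> L" for x y
    using that unfolding L lattice_span_def by (auto simp: plucker_combination)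
  have d: "plucker a b $ i $ j * d (x, y) = plucker x y $ i $ j" if "x \<in> L" "y \<in> L" for x y
    using dvd[OF that] by (simp add: d_def)
  interpret Z: comm_group integer_group by (rule abelian_integer_group)
  obtain h where h: "h \<in> hom F integer_group" and h_of: "\<And>p. p \<in> L \<times> L \<Longrightarrow> h (frag_of p) = d p"
    using Z.free_Abelian_group_universal[of d "L \<times> L"] by auto
  interpret h: group_hom F integer_group h
    using h by unfold_locales
  have h_add: "h (f + g) = h f + h g" if "f \<in> carrier F" "g \<in> carrier F" for f g
    using hom_mult[OF h that] by simp
  have h_diff: "h (f - g) = h f - h g" if "f \<in> carrier F" "g \<in> carrier F" for f g
    using h_add[OF free_Abelian_group_diff_closed[OF that] that(2)] by simp
  have h_frag: "h (frag_of (x, y)) = d (x, y)" if "x \<in> L" "y \<in> L" for x y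
    using h_of that by simp
  have cancel: "u = v" if "plucker a b $ i $ j * u = plucker a b $ i $ j * v" for u v
    using that m by simp
  have rel: "h r = 0" if r: "r \<in> wedge_relations L" for r
  proof -
    consider x y z where "x \<in> L" "y \<in> L" "z \<in> L"
        "r = frag_of (x + y, z) - frag_of (x, z) - frag_of (y, z)"
      | x y z where "x \<in> L" "y \<in> L" "z \<in> L"
        "r = frag_of (x, y + z) - frag_of (x, y) - frag_of (x, z)"
      | x where "x \<in> L" "r = frag_of (x, x)"
      using r unfolding wedge_relations_def by blast
    then show ?thesis
    proof cases
      case 1
      have "h r = d (x + y, z) - d (x, z) - d (y, z)"
        using 1 by (simp only: h_diff free_Abelian_group_diff_closed frag_of_mem add_closed h_frag)
      also have "\<dots> = 0"
        by (rule cancel) (simp add: right_diff_distrib d add_closed 1, simp add: plucker_nth algebra_simps)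
      finally show ?thesis .
    next
      case 2
      have "h r = d (x, y + z) - d (x, y) - d (x, z)"
        using 2 by (simp only: h_diff free_Abelian_group_diff_closed frag_of_mem add_closed h_frag)
      also have "\<dots> = 0"
        by (rule cancel) (simp add: right_diff_distrib d add_closed 2, simp add: plucker_nth algebra_simps)
      finally show ?thesis .
    next
      case 3
      then show ?thesis by (simp add: h_frag d_def plucker_nth)
    qed
  qed
  have "wedge_kernel L \<subseteq> kernel F integer_group h"
    unfolding wedge_kernel_def
  proof (rule F.generate_subgroup_incl[OF _ h.subgroup_kernel])
    show "wedge_relations L \<subseteq> kernel F integer_group h"
      using rel wedge_relations_subset[OF add_closed] unfolding kernel_def by fastforce
  qed
  then obtain g where g: "g \<in> hom (exterior_square L) integer_group"
    and g_class: "\<And>f. f \<in> carrier F \<Longrightarrow> g (wedge_kernel L #>\<^bsub>F\<^esub> f) = h f"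
    unfolding exterior_square_def using h.FactGroup_universal_kernel[OF wedge_kernel_normal] by blast
  note w = wedge_generators_closed
  have g1: "g (wedge L a b) = 1"
    unfolding wedge_def using generators_mem m by (simp add: g_class h_frag) (simp add: d_def)
  have pow: "g (wedge L a b [^]\<^bsub>exterior_square L\<^esub> n) = n" for n :: int
    using hom_int_pow[OF g w E.is_group group_integer_group] g1 by simp
  have "bij_betw g (carrier (exterior_square L)) UNIV"
  proof (rule bij_betwI')
    fix X Y assume "X \<in> carrier (exterior_square L)" "Y \<in> carrier (exterior_square L)"
    then show "g X = g Y \<longleftrightarrow> X = Y" by (metis pow exterior_square_cyclic)
  next
    fix n :: int
    show "\<exists>X\<in>carrier (exterior_square L). n = g X"
      using pow w by (intro bexI[of _ "wedge L a b [^]\<^bsub>exterior_square L\<^esub> n"]) auto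
  qed simp
  then have "restrict g (carrier (exterior_square L)) \<in> orientations L"
    using g E.is_group by (auto simp: orientations_def iso_def bij_betw_restrict_eq hom_def)
  then show ?thesis using that g1 w by simp
qed

end

section \<open>Antisymmetric integer matrices of rank two\<close>

definition antisymmetric :: "int ^ 'n ^ 'n \<Rightarrow> bool" where
  "antisymmetric M \<longleftrightarrow> (\<forall>i j. M $ i $ j = - M $ j $ i)"

definition plucker_relations :: "int ^ 'n ^ 'n \<Rightarrow> bool" where
  "plucker_relations M \<longleftrightarrow>
     (\<forall>i j k l. M $ i $ j * M $ k $ l = M $ i $ k * M $ j $ l - M $ i $ l * M $ j $ k)"

lemma antisymmetricD: "antisymmetric M \<Longrightarrow> M $ i $ j = - M $ j $ i"
  unfolding antisymmetric_def by blast

lemma antisymmetric_diagonal: "antisymmetric M \<Longrightarrow> M $ i $ i = 0"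
  using antisymmetricD[of M i i] by simp

lemma antisymmetric_plucker: "antisymmetric (plucker a b)"
  by (simp add: antisymmetric_def plucker_nth)

lemma rows_independent:
  fixes A :: "real ^ 'n ^ 'm"
  assumes "A $ i $ k \<noteq> 0" "A $ j $ l \<noteq> 0" "A $ j $ k = 0"
  shows "A $ i \<noteq> A $ j" "independent {A $ i, A $ j}"
proof -
  show ne: "A $ i \<noteq> A $ j" using assms by metis
  have "A $ i \<notin> span {A $ j}"
    using assms by (auto simp: span_singleton)
  moreover have "A $ j \<noteq> 0" using assms by auto
  ultimately show "independent {A $ i, A $ j}" using ne by (simp add: independent_insert)
qed

text \<open>
  Choose an entry \<open>(i, j)\<close> with \<open>A\<^sub>i\<^sub>j \<noteq> 0\<close>. Rows \<open>i\<close> and \<open>j\<close> are independent because of the zero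
  diagonal, so they span the row space. The coefficients of row \<open>k\<close> in terms of them are read off in
  columns \<open>i\<close> and \<open>j\<close>. The outcome is that \<open>A\<^sub>i\<^sub>j A\<close> is the Pluecker matrix of rows \<open>i\<close> and \<open>j\<close>, and
  Pluecker matrices satisfy the relations identically.
\<close>
lemma relations_of_rank_two:
  assumes M: "antisymmetric M" and rank: "rank (map_matrix real_of_int M) = 2"
  shows "plucker_relations M"
proof -
  define A where "A = map_matrix real_of_int M"
  have A: "A $ i $ j = of_int (M $ i $ j)" for i j
    by (simp add: A_def map_matrix_def)
  have anti: "A $ i $ j = - A $ j $ i" for i j
    using antisymmetricD[OF M, of i j] by (simp add: A)
  have diag: "A $ i $ i = 0" for i
    using antisymmetric_diagonal[OF M] by (simp add: A)
  have "A \<noteq> 0" using rank unfolding A_def[symmetric] by auto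
  then obtain i j where m: "A $ i $ j \<noteq> 0" by (auto simp: vec_eq_iff)
  have ji: "A $ j $ i = - A $ i $ j" by (rule anti)
  have rows: "A $ k \<in> rows A" for k by (auto simp: rows_def row_def vec_nth_inverse)
  have ne: "A $ i \<noteq> A $ j" and indep: "independent {A $ i, A $ j}"
    using rows_independent[of A i j j i] diag m ji by auto
  have "rows A \<subseteq> span {A $ i, A $ j}"
  proof (rule card_ge_dim_independent)
    show "{A $ i, A $ j} \<subseteq> rows A" using rows by auto
    show "dim (rows A) \<le> card {A $ i, A $ j}"
      using rank ne by (simp add: A_def[symmetric] row_rank_def)
  qed (rule indep)
  then have "A $ k \<in> span {A $ i, A $ j}" for k using rows by blast
  then have "\<exists>u v. A $ k = u *\<^sub>R A $ i + v *\<^sub>R A $ j" for k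
    unfolding span_insert span_singleton
    by (auto simp: algebra_simps)
  then obtain u v where uv: "\<And>k. A $ k = u k *\<^sub>R A $ i + v k *\<^sub>R A $ j" by metis
  have vk: "v k * A $ i $ j = - A $ k $ i" and uk: "u k * A $ i $ j = A $ k $ j" for k
    using arg_cong[OF uv[of k], of "\<lambda>x. x $ i"] arg_cong[OF uv[of k], of "\<lambda>x. x $ j"] diag ji by simp_all
  have key: "A $ i $ j * A $ k $ l = A $ k $ j * A $ i $ l - A $ k $ i * A $ j $ l" for k l
  proof -
    have "A $ i $ j * A $ k $ l = (u k * A $ i $ j) * A $ i $ l + (v k * A $ i $ j) * A $ j $ l"
      using arg_cong[OF uv[of k], of "\<lambda>x. x $ l"] by (simp add: algebra_simps)
    then show ?thesis unfolding uk vk by simp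
  qed
  have rel: "A $ p $ q * A $ k $ l = A $ p $ k * A $ q $ l - A $ p $ l * A $ q $ k" for p q k l
  proof -
    (* Up to the factor A $ i $ j, the matrix A is the Pluecker matrix of its rows i and j. *)
    define x y where "x = A $ i" and "y = A $ j"
    have xy: "A $ i $ j * A $ k $ l = x $ k * y $ l - y $ k * x $ l" for k l
      unfolding key x_def y_def using anti[of k i] anti[of k j] by simp
    have "(A $ i $ j * A $ p $ q) * (A $ i $ j * A $ k $ l) =
      (A $ i $ j * A $ p $ k) * (A $ i $ j * A $ q $ l) - (A $ i $ j * A $ p $ l) * (A $ i $ j * A $ q $ k)"
      unfolding xy by (simp add: algebra_simps)
    then have "(A $ i $ j * A $ i $ j) * (A $ p $ q * A $ k $ l) =
      (A $ i $ j * A $ i $ j) * (A $ p $ k * A $ q $ l - A $ p $ l * A $ q $ k)"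
      by (simp add: algebra_simps)
    then show ?thesis using m by simp
  qed
  show ?thesis
    unfolding plucker_relations_def
  proof (intro allI)
    fix p q k l
    have "real_of_int (M $ p $ q * M $ k $ l) = real_of_int (M $ p $ k * M $ q $ l - M $ p $ l * M $ q $ k)"
      using rel[of p q k l] by (simp add: A)
    then show "M $ p $ q * M $ k $ l = M $ p $ k * M $ q $ l - M $ p $ l * M $ q $ k"
      by linarith
  qed
qed

text \<open>
  The rows of \<open>plucker a b\<close> are combinations of \<open>a\<close> and \<open>b\<close>, and a nonzero entry \<open>(i, j)\<close> makes rows
  \<open>i\<close> and \<open>j\<close> independent.
\<close>
lemma rank_plucker:
  fixes a b :: "int ^ 'n::finite"
  assumes "plucker a b \<noteq> 0"
  shows "rank (map_matrix real_of_int (plucker a b)) = 2"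
proof -
  define A where "A = map_matrix real_of_int (plucker a b)"
  define x y :: "real ^ 'n" where "x = (\<chi> i. of_int (a $ i))" and "y = (\<chi> i. of_int (b $ i))"
  have A: "A $ i = x $ i *\<^sub>R y - y $ i *\<^sub>R x" for i
    by (simp add: A_def map_matrix_def plucker_nth x_def y_def vec_eq_iff)
  have R: "rows A = range (($) A)" by (auto simp: rows_def row_def vec_nth_inverse)
  have diag: "A $ i $ i = 0" for i by (simp add: A)
  obtain i j where "plucker a b $ i $ j \<noteq> 0" using assms by (rule plucker_nonzero_entry)
  then have "of_int (plucker a b $ i $ j) \<noteq> (0 :: real)" by simp
  then have m: "A $ i $ j \<noteq> 0" "A $ j $ i \<noteq> 0"
    by (simp_all add: A_def map_matrix_def plucker_nth)
  have "dim (rows A) \<le> card {x, y}"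
  proof (rule dim_le_card)
    show "rows A \<subseteq> span {x, y}"
      unfolding R A by (auto intro!: span_diff span_scale intro: span_base)
  qed simp
  then have "dim (rows A) \<le> 2" using card_2_iff[of "{x, y}"] by (cases "x = y") auto
  moreover have ne: "A $ i \<noteq> A $ j" and indep: "independent {A $ i, A $ j}"
    using rows_independent[of A i j j i] diag m by auto
  have "card {A $ i, A $ j} \<le> dim (rows A)"
    using indep unfolding R by (intro independent_card_le_dim) auto
  ultimately show ?thesis using ne by (simp add: A_def[symmetric] row_rank_def)
qed

lemma Bezout_sum:
  fixes f :: "'a \<Rightarrow> int"
  assumes "finite S"
  shows "\<exists>u. (\<Sum>k\<in>S. u k * f k) = Gcd (f ` S)"
  using assms
proof induction
  case empty
  show ?case by simp
next
  case (insert k S)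
  then obtain u where u: "(\<Sum>k\<in>S. u k * f k) = Gcd (f ` S)" by auto
  obtain p q where pq: "p * f k + q * Gcd (f ` S) = gcd (f k) (Gcd (f ` S))"
    using bezout_int by blast
  have "(\<Sum>l\<in>S. (if l = k then p else q * u l) * f l) = q * (\<Sum>l\<in>S. u l * f l)"
    unfolding sum_distrib_left using insert.hyps by (intro sum.cong) auto
  then show ?case
    using insert.hyps u pq by (intro exI[of _ "\<lambda>l. if l = k then p else q * u l"]) simp
qed

text \<open>
  Suppose \<open>M = plucker a b\<close> were known with \<open>b\<^sub>i = 0\<close>. Row \<open>i\<close> would be \<open>a\<^sub>i b\<close>, which suggests to take for
  \<open>b\<close> the \<open>i\<close>-th row divided by its content \<open>d\<close>. Contracting \<open>M\<close> with a vector \<open>u\<close> such that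
  \<open>\<Sum>\<^sub>t u\<^sub>t b\<^sub>t = 1\<close> would give \<open>a\<close> up to a multiple of \<open>b\<close>, which does not change \<open>plucker a b\<close>; such
  a \<open>u\<close> exists by Bezout. The Pluecker relations of \<open>M\<close> confirm that these choices work. As \<open>b\<close> is a
  rational multiple of a row of \<open>M\<close> and \<open>a\<close> is a combination of its columns, their coordinate sums
  vanish along with those of \<open>M\<close>.
\<close>
lemma decomposable:
  fixes M :: "int ^ 'n::finite ^ 'n"
  assumes M: "antisymmetric M" and rel: "plucker_relations M" and "M \<noteq> 0"
    and zero: "\<And>i. (\<Sum>j\<in>UNIV. M $ i $ j) = 0"
  obtains a b where "M = plucker a b" "(\<Sum>j\<in>UNIV. a $ j) = 0" "(\<Sum>j\<in>UNIV. b $ j) = 0"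
proof -
  obtain i j where ij: "M $ i $ j \<noteq> 0" using \<open>M \<noteq> 0\<close> by (auto simp: vec_eq_iff)
  define d where "d = Gcd (range (($) (M $ i)))"
  have "d \<noteq> 0" using ij unfolding d_def by auto
  obtain u where u: "(\<Sum>t\<in>UNIV. u t * M $ i $ t) = d"
    using Bezout_sum[of UNIV "($) (M $ i)"] unfolding d_def by auto
  define a b :: "int ^ 'n"
    where "a = (\<chi> k. \<Sum>t\<in>UNIV. u t * M $ k $ t)" and "b = (\<chi> k. M $ i $ k div d)"
  have b: "d * b $ k = M $ i $ k" for k
    unfolding b_def by (simp add: d_def)
  have "d * (a $ k * b $ l - a $ l * b $ k) = d * M $ k $ l" for k l
  proof -
    have "d * (a $ k * b $ l - a $ l * b $ k) = a $ k * (d * b $ l) - a $ l * (d * b $ k)"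
      by (simp add: algebra_simps)
    also have "\<dots> = (\<Sum>t\<in>UNIV. u t * (M $ k $ t * M $ i $ l - M $ l $ t * M $ i $ k))"
      unfolding b a_def by (simp add: sum_distrib_left sum_distrib_right sum_subtractf algebra_simps)
    also have "\<dots> = (\<Sum>t\<in>UNIV. u t * (M $ i $ t * M $ k $ l))"
    proof (rule sum.cong)
      fix t
      have "M $ i $ t * M $ k $ l = M $ i $ k * M $ t $ l - M $ i $ l * M $ t $ k"
        using rel unfolding plucker_relations_def by blast
      then have "M $ k $ t * M $ i $ l - M $ l $ t * M $ i $ k = M $ i $ t * M $ k $ l"
        using antisymmetricD[OF M, of t l] antisymmetricD[OF M, of t k] by simp
      then show "u t * (M $ k $ t * M $ i $ l - M $ l $ t * M $ i $ k) = u t * (M $ i $ t * M $ k $ l)"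
        by simp
    qed simp
    also have "\<dots> = d * M $ k $ l"
      unfolding u[symmetric] by (simp add: sum_distrib_right mult.assoc)
    finally show ?thesis .
  qed
  then have "M = plucker a b"
    using \<open>d \<noteq> 0\<close> by (simp add: vec_eq_iff plucker_nth)
  moreover have "(\<Sum>k\<in>UNIV. a $ k) = 0"
  proof -
    have "(\<Sum>k\<in>UNIV. a $ k) = (\<Sum>t\<in>UNIV. \<Sum>k\<in>UNIV. u t * M $ k $ t)"
      unfolding a_def by (simp, rule sum.swap)
    also have "\<dots> = (\<Sum>t\<in>UNIV. - u t * (\<Sum>k\<in>UNIV. M $ t $ k))"
    proof (rule sum.cong)
      fix t
      show "(\<Sum>k\<in>UNIV. u t * M $ k $ t) = - u t * (\<Sum>k\<in>UNIV. M $ t $ k)"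
        unfolding sum_distrib_left by (rule sum.cong) (simp_all add: antisymmetricD[OF M, of _ t])
    qed simp
    finally show ?thesis by (simp add: zero)
  qed
  moreover have "(\<Sum>k\<in>UNIV. b $ k) = 0"
  proof -
    have "d * (\<Sum>k\<in>UNIV. b $ k) = 0"
      unfolding sum_distrib_left b by (rule zero)
    then show ?thesis using \<open>d \<noteq> 0\<close> by simp
  qed
  ultimately show ?thesis by (rule that)
qed

section \<open>Quivers and antisymmetric matrices\<close>

lemma antisym_adjacency_nth:
  "antisym_adjacency Q $ i $ j = int (count Q (i, j)) - int (count Q (j, i))"
  by (simp add: antisym_adjacency_def adjacency_def)

lemma antisymmetric_antisym_adjacency: "antisymmetric (antisym_adjacency Q)"
  by (simp add: antisymmetric_def antisym_adjacency_nth)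

text \<open>
  If one of \<open>p, q\<close> is zero, then the positive parts of \<open>p - q\<close> and \<open>q - p\<close> are \<open>p\<close> and \<open>q\<close>. So without
  short loops the antisymmetrized matrix determines the quiver.
\<close>
lemma no_short_loops_iff:
  "no_short_loops Q \<longleftrightarrow> (\<forall>i j. count Q (i, j) = nat (antisym_adjacency Q $ i $ j))"
proof -
  have "(\<forall>i j. p i j * p j i = (0::nat)) \<longleftrightarrow>
      (\<forall>i j. p i j = nat (int (p i j) - int (p j i)))"
    for p :: "'a \<Rightarrow> 'a \<Rightarrow> nat"
  proof (intro iffI allI)
    fix i j assume "\<forall>i j. p i j * p j i = 0"
    then have "p i j = 0 \<or> p j i = 0" by simp
    then show "p i j = nat (int (p i j) - int (p j i))" by auto
  next
    fix i j assume "\<forall>i j. p i j = nat (int (p i j) - int (p j i))"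
    then have "p i j = nat (int (p i j) - int (p j i))" "p j i = nat (int (p j i) - int (p i j))" by blast+
    then have "p i j = 0 \<or> p j i = 0" by linarith
    then show "p i j * p j i = 0" by simp
  qed
  then show ?thesis
    by (simp add: no_short_loops_def adjacency_def antisym_adjacency_nth)
qed

lemma quiver_eqI:
  assumes "no_short_loops Q" "no_short_loops R" "antisym_adjacency Q = antisym_adjacency R"
  shows "Q = R"
proof (rule multiset_eqI)
  fix e :: "'a \<times> 'a"
  show "count Q e = count R e"
    using assms by (cases e) (simp add: no_short_loops_iff)
qed

lemma quiver_of_matrix:
  fixes M :: "int ^ 'n::finite ^ 'n"
  assumes "antisymmetric M"
  obtains Q where "no_short_loops Q" "antisym_adjacency Q = M"
proof -
  define Q where "Q = Abs_multiset (\<lambda>(i, j). nat (M $ i $ j))"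
  have count: "count Q (i, j) = nat (M $ i $ j)" for i j
    unfolding Q_def by (simp add: count_Abs_multiset)
  have "antisym_adjacency Q $ i $ j = M $ i $ j" for i j
    using antisymmetricD[OF assms, of j i] by (simp add: antisym_adjacency_nth count)
  then have M: "antisym_adjacency Q = M" by (simp add: vec_eq_iff)
  then have "no_short_loops Q" unfolding no_short_loops_iff by (simp add: count)
  then show ?thesis using M by (rule that)
qed

lemma outgoing_eq_sum:
  fixes Q :: "'n::finite quiver"
  shows "outgoing Q i = (\<Sum>j\<in>UNIV. count Q (i, j))"
  unfolding outgoing_def
proof (induction Q)
  case (add e Q)
  obtain k l where e: "e = (k, l)" by (cases e)
  have "(\<Sum>j\<in>UNIV. count (add_mset e Q) (i, j)) =
      (\<Sum>j\<in>UNIV. count Q (i, j)) + (\<Sum>j\<in>UNIV. if j = l then of_bool (k = i) else 0)"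
    unfolding e sum.distrib[symmetric] by (rule sum.cong) auto
  then show ?case using add by (simp add: e)
qed simp

lemma incoming_eq_sum:
  fixes Q :: "'n::finite quiver"
  shows "incoming Q j = (\<Sum>i\<in>UNIV. count Q (i, j))"
  unfolding incoming_def
proof (induction Q)
  case (add e Q)
  obtain k l where e: "e = (k, l)" by (cases e)
  have "(\<Sum>i\<in>UNIV. count (add_mset e Q) (i, j)) =
      (\<Sum>i\<in>UNIV. count Q (i, j)) + (\<Sum>i\<in>UNIV. if i = k then of_bool (l = j) else 0)"
    unfolding e sum.distrib[symmetric] by (rule sum.cong) auto
  then show ?case using add by (simp add: e)
qed simp

lemma balanced_iff:
  fixes Q :: "'n::finite quiver"
  shows "incoming Q i = outgoing Q i \<longleftrightarrow> (\<Sum>j\<in>UNIV. antisym_adjacency Q $ i $ j) = 0"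
proof -
  have "(\<Sum>j\<in>UNIV. antisym_adjacency Q $ i $ j) = int (outgoing Q i) - int (incoming Q i)"
    by (simp add: incoming_eq_sum outgoing_eq_sum antisym_adjacency_nth sum_subtractf)
  then show ?thesis by linarith
qed

lemma isolated_node_iff:
  fixes Q :: "'n::finite quiver"
  assumes "no_short_loops Q"
  shows "isolated_node Q i \<longleftrightarrow> antisym_adjacency Q $ i = 0"
proof -
  have "isolated_node Q i \<longleftrightarrow> (\<forall>j. count Q (i, j) = 0 \<and> count Q (j, i) = 0)"
    unfolding isolated_node_def count_eq_zero_iff by auto
  also have "\<dots> \<longleftrightarrow> antisym_adjacency Q $ i = 0"
  proof
    assume "\<forall>j. count Q (i, j) = 0 \<and> count Q (j, i) = 0"
    then show "antisym_adjacency Q $ i = 0" by (simp add: vec_eq_iff antisym_adjacency_nth)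
  next
    assume z: "antisym_adjacency Q $ i = 0"
    have "antisym_adjacency Q $ j $ i = 0" for j
      using antisymmetricD[OF antisymmetric_antisym_adjacency, of Q j i] z by simp
    then show "\<forall>j. count Q (i, j) = 0 \<and> count Q (j, i) = 0"
      using assms z by (simp add: no_short_loops_iff)
  qed
  finally show ?thesis .
qed

lemma good_quiver_iff:
  fixes Q :: "'n::finite quiver"
  shows "good_quiver Q \<longleftrightarrow>
    no_short_loops Q \<and> (\<forall>i. antisym_adjacency Q $ i \<noteq> 0) \<and>
    (\<forall>i. (\<Sum>j\<in>UNIV. antisym_adjacency Q $ i $ j) = 0) \<and>
    rank (map_matrix real_of_int (antisym_adjacency Q)) = 2"
  unfolding good_quiver_def antisym_rank_def by (auto simp: balanced_iff isolated_node_iff)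

section \<open>The matrix of the Pluecker form\<close>

lemma vector_matrix_mult_rows:
  "c v* B = (c $ 1) *s row 1 B + (c $ 2) *s row (2 :: 2) (B :: int ^ 'n ^ 2)"
  by (simp add: vec_eq_iff vector_matrix_mult_def sum_2 row_def)

lemma column_det_eq: "column_det B i j = plucker (row 1 B) (row 2 B) $ i $ j"
  by (simp add: column_det_def det_2 transpose_def column_def plucker_nth row_def mult.commute)

text \<open>Cramer's rule at a nonzero entry of the Pluecker matrix.\<close>
lemma combination_eqD:
  assumes "plucker a b \<noteq> 0" "s *s a + t *s b = s' *s a + t' *s b"
  shows "s = s'" "t = t'"
proof -
  obtain i j where m: "plucker a b $ i $ j \<noteq> 0" using assms(1) by (rule plucker_nonzero_entry)
  have e: "s * a $ k + t * b $ k = s' * a $ k + t' * b $ k" for k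
    using arg_cong[OF assms(2), of "\<lambda>x. x $ k"] by simp
  have "(s - s') * plucker a b $ i $ j = 0" "(t - t') * plucker a b $ i $ j = 0"
    using e[of i] e[of j] unfolding plucker_nth by algebra+
  then show "s = s'" "t = t'" using m by simp_all
qed

text \<open>
  If the Pluecker matrix vanishes then \<open>a\<^sub>i b - b\<^sub>i a = 0\<close> for every \<open>i\<close>, so injectivity of the coordinate
  map would force \<open>a = 0\<close>, which contradicts injectivity.
\<close>
lemma is_lattice_basis_iff:
  "is_lattice_basis L B \<longleftrightarrow> L = lattice_span (row 1 B) (row 2 B) \<and> plucker (row 1 B) (row 2 B) \<noteq> 0"
proof -
  define a b where "a = row 1 B" and "b = row 2 B"
  have f: "(\<lambda>c. c v* B) = (\<lambda>c. (c $ 1) *s a + (c $ 2) *s b)"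
    by (simp add: vector_matrix_mult_rows a_def b_def)
  have range: "range (\<lambda>c :: int ^ 2. (c $ 1) *s a + (c $ 2) *s b) = lattice_span a b"
  proof -
    have "s *s a + t *s b \<in> range (\<lambda>c :: int ^ 2. (c $ 1) *s a + (c $ 2) *s b)" for s t
      by (rule range_eqI[of _ _ "vector [s, t]"]) simp
    then show ?thesis by (auto simp: lattice_span_def)
  qed
  have inj: "inj (\<lambda>c :: int ^ 2. (c $ 1) *s a + (c $ 2) *s b) \<longleftrightarrow> plucker a b \<noteq> 0"
  proof
    assume inj: "inj (\<lambda>c :: int ^ 2. (c $ 1) *s a + (c $ 2) *s b)"
    have D: "s = 0 \<and> t = 0" if "s *s a + t *s b = 0" for s t
      using injD[OF inj, of "vector [s, t]" 0] that by (simp add: vec_eq_iff forall_2)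
    show "plucker a b \<noteq> 0"
    proof
      assume z: "plucker a b = 0"
      have "(- b $ i) *s a + (a $ i) *s b = 0" for i
        using arg_cong[OF z, of "\<lambda>M. M $ i"] by (simp add: vec_eq_iff plucker_nth algebra_simps)
      from D[OF this] have "1 *s a + 0 *s b = 0" by (simp add: vec_eq_iff)
      then show False using D[of 1 0] by simp
    qed
  next
    assume "plucker a b \<noteq> 0"
    then show "inj (\<lambda>c :: int ^ 2. (c $ 1) *s a + (c $ 2) *s b)"
      by (intro injI) (auto simp: vec_eq_iff[where 'b = 2] forall_2 dest: combination_eqD)
  qed
  show ?thesis
    unfolding is_lattice_basis_def bij_betw_def f range inj unfolding a_def b_def by auto
qed

lemma rows_vector:
  "row 1 (vector [a, b] :: int ^ 'n ^ 2) = a" "row 2 (vector [a, b] :: int ^ 'n ^ 2) = b"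
  by (simp_all add: row_def vec_eq_iff)

definition oriented_basis :: "(int ^ 'n) set \<Rightarrow> 'n orientation \<Rightarrow> int ^ 'n \<Rightarrow> int ^ 'n \<Rightarrow> bool" where
  "oriented_basis L \<omega> a b \<longleftrightarrow> L = lattice_span a b \<and> plucker a b \<noteq> 0 \<and> \<omega> (wedge L a b) = 1"

lemma oriented_basisD:
  assumes "oriented_basis L \<omega> a b"
  shows "L = lattice_span a b" "plucker a b \<noteq> 0" "\<omega> (wedge L a b) = 1"
  using assms unfolding oriented_basis_def by blast+

lemma is_oriented_basis_iff: "is_oriented_basis L \<omega> B \<longleftrightarrow> oriented_basis L \<omega> (row 1 B) (row 2 B)"
  unfolding is_oriented_basis_def oriented_basis_def is_lattice_basis_iff by auto

text \<open>
  The determinant of the base change is the value of \<open>\<omega>\<close> at the second basis, which is 1, and it is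
  also the factor between the two Pluecker matrices.
\<close>
lemma oriented_basis_plucker_unique:
  assumes \<omega>: "\<omega> \<in> orientations L" and ab: "oriented_basis L \<omega> a b" and cd: "oriented_basis L \<omega> c d"
  shows "plucker c d = plucker a b"
proof -
  note L = oriented_basisD(1)[OF ab]
  have "c \<in> L" "d \<in> L"
    unfolding oriented_basisD(1)[OF cd] by (rule generators_in_lattice_span)+
  then obtain s t s' t' where c: "c = s *s a + t *s b" and d: "d = s' *s a + t' *s b"
    unfolding L lattice_span_def by auto
  have "\<omega> (wedge L c d) = (s * t' - t * s') * \<omega> (wedge L a b)"
    unfolding c d by (rule hom_exterior_square_wedge[OF L orientation_hom[OF L \<omega>]])
  then have "s * t' - t * s' = 1"
    using oriented_basisD(3)[OF ab] oriented_basisD(3)[OF cd] by simp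
  then show ?thesis
    by (simp add: vec_eq_iff[where 'b = 'a] c d plucker_combination)
qed

lemma plucker_matrix_eq:
  assumes \<omega>: "\<omega> \<in> orientations L" and ab: "oriented_basis L \<omega> a b"
  shows "plucker_matrix L \<omega> = plucker a b"
proof -
  have "is_oriented_basis L \<omega> (vector [a, b])"
    using ab by (simp add: is_oriented_basis_iff rows_vector)
  then have "is_oriented_basis L \<omega> (SOME B. is_oriented_basis L \<omega> B)" (is "is_oriented_basis L \<omega> ?B")
    by (rule someI)
  then have "plucker (row 1 ?B) (row 2 ?B) = plucker a b"
    unfolding is_oriented_basis_iff using oriented_basis_plucker_unique[OF \<omega> ab] by blast
  then show ?thesis
    by (simp add: plucker_matrix_def Let_def column_det_eq vec_eq_iff)
qed

text \<open>If a basis has the wrong sign, exchange its two vectors.\<close>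
lemma oriented_basis_exists:
  assumes "rank_two_subgroup L" and \<omega>: "\<omega> \<in> orientations L"
  obtains a b where "oriented_basis L \<omega> a b"
proof -
  obtain B where "is_lattice_basis L B" using assms by (auto simp: rank_two_subgroup_def)
  then obtain a b where L: "L = lattice_span a b" and ab: "plucker a b \<noteq> 0"
    unfolding is_lattice_basis_iff by blast
  consider "\<omega> (wedge L a b) = 1" | "\<omega> (wedge L a b) = -1"
    using orientation_of_basis[OF L \<omega>] by linarith
  then show ?thesis
  proof cases
    case 1
    with L ab show ?thesis by (intro that) (simp add: oriented_basis_def)
  next
    case 2
    have "\<omega> (wedge L b a) = 1"
      using hom_exterior_square_wedge[OF L orientation_hom[OF L \<omega>], of 0 1 1 0] 2 by simp
    moreover have "L = lattice_span b a"
      unfolding L lattice_span_def by (metis add.commute)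
    moreover have "plucker b a \<noteq> 0"
      using ab by (auto simp: vec_eq_iff plucker_nth algebra_simps)
    ultimately show ?thesis by (intro that) (simp add: oriented_basis_def)
  qed
qed

lemma plucker_quiver_eq_iff:
  assumes "antisymmetric (plucker_matrix L \<omega>)"
  shows "plucker_quiver L \<omega> = Q \<longleftrightarrow> no_short_loops Q \<and> antisym_adjacency Q = plucker_matrix L \<omega>"
proof -
  obtain R where "no_short_loops R" "antisym_adjacency R = plucker_matrix L \<omega>"
    using assms by (rule quiver_of_matrix)
  then have R: "\<exists>!R. no_short_loops R \<and> antisym_adjacency R = plucker_matrix L \<omega>"
    by (intro ex1I[of _ R]) (simp_all add: quiver_eqI)
  show ?thesis
    unfolding plucker_quiver_def using theI'[OF R] the1_equality[OF R, of Q] by metis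
qed

section \<open>Admissible and saturated lattices\<close>

lemma lattice_group_simps:
  "carrier lattice_group = UNIV" "x \<otimes>\<^bsub>lattice_group\<^esub> y = x + y" "\<one>\<^bsub>lattice_group\<^esub> = 0"
  by (simp_all add: lattice_group_def)

lemma comm_group_lattice_group: "comm_group lattice_group"
  by (rule comm_groupI)
    (auto simp: lattice_group_simps algebra_simps intro!: exI[of _ "- x" for x])

lemma pow_lattice_group: "x [^]\<^bsub>lattice_group\<^esub> (k :: nat) = of_nat k *s x"
proof -
  interpret comm_group "lattice_group :: (int ^ 'a) monoid" by (rule comm_group_lattice_group)
  show ?thesis
    by (induction k) (simp_all add: lattice_group_simps vec_eq_iff algebra_simps)
qed

lemma subgroup_lattice_span: "subgroup (lattice_span a b) lattice_group"
proof -
  interpret comm_group "lattice_group :: (int ^ 'a) monoid" by (rule comm_group_lattice_group)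
  show ?thesis
  proof (rule subgroupI)
    fix x assume x: "x \<in> lattice_span a b"
    have "inv\<^bsub>lattice_group\<^esub> x = (-1) *s x"
      by (rule inv_equality) (simp_all add: lattice_group_simps vec_eq_iff)
    then show "inv\<^bsub>lattice_group\<^esub> x \<in> lattice_span a b"
      using lattice_span_scale[OF x] by simp
  next
    show "lattice_span a b \<noteq> {}" using generators_in_lattice_span by blast
  qed (auto simp: lattice_group_simps lattice_span_add)
qed

lemma torsion_free_Mod_iff:
  assumes L: "subgroup L lattice_group"
  shows "torsion_free (lattice_group Mod L) \<longleftrightarrow>
    (\<forall>x. \<forall>k :: nat. k > 0 \<longrightarrow> of_nat k *s x \<in> L \<longrightarrow> x \<in> L)"
proof -
  interpret comm_group "lattice_group :: (int ^ 'a) monoid" by (rule comm_group_lattice_group)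
  interpret normal L lattice_group using L by (rule subgroup_imp_normal)
  have coset: "L #>\<^bsub>lattice_group\<^esub> x = L \<longleftrightarrow> x \<in> L" for x
    using coset_join1[of L x] coset_join2[of x L] L subgroup_axioms
    by (auto simp: lattice_group_simps)
  have pow: "(L #>\<^bsub>lattice_group\<^esub> x) [^]\<^bsub>lattice_group Mod L\<^esub> k = L #>\<^bsub>lattice_group\<^esub> (of_nat k *s x)"
    for x and k :: nat
    using FactGroup_pow[of x k] by (simp add: pow_lattice_group lattice_group_simps)
  show ?thesis
    unfolding torsion_free_def carrier_FactGroup by (simp add: pow coset lattice_group_simps)
qed

lemma plucker_row_eq_0_iff:
  assumes "plucker a b \<noteq> 0"
  shows "plucker a b $ i = 0 \<longleftrightarrow> a $ i = 0 \<and> b $ i = 0"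
proof
  assume z: "plucker a b $ i = 0"
  have "(- b $ i) *s a + (a $ i) *s b = 0 *s a + 0 *s b"
    using z by (simp add: vec_eq_iff plucker_nth algebra_simps)
  from combination_eqD[OF assms this] show "a $ i = 0 \<and> b $ i = 0" by simp
qed (simp add: vec_eq_iff plucker_nth)

lemma admissible_lattice_span_iff:
  fixes a b :: "int ^ 'n::finite"
  assumes ab: "plucker a b \<noteq> 0"
  shows "admissible (lattice_span a b) \<longleftrightarrow>
    (\<forall>i. plucker a b $ i \<noteq> 0) \<and> (\<Sum>j\<in>UNIV. a $ j) = 0 \<and> (\<Sum>j\<in>UNIV. b $ j) = 0"
proof -
  have "rank_two_subgroup (lattice_span a b)"
    unfolding rank_two_subgroup_def is_lattice_basis_iff
    using subgroup_lattice_span ab rows_vector by metis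
  moreover have "lattice_span a b \<subseteq> coord_hyperplane i \<longleftrightarrow> plucker a b $ i = 0" for i
    unfolding plucker_row_eq_0_iff[OF ab] coord_hyperplane_def
    using generators_in_lattice_span(1)[of a b] generators_in_lattice_span(2)[of b a] by (auto simp: lattice_span_def)
  moreover have "(\<forall>l\<in>lattice_span a b. (\<Sum>j\<in>UNIV. l $ j) = 0) \<longleftrightarrow>
      (\<Sum>j\<in>UNIV. a $ j) = 0 \<and> (\<Sum>j\<in>UNIV. b $ j) = 0"
    using generators_in_lattice_span(1)[of a b] generators_in_lattice_span(2)[of b a]
    by (auto simp: lattice_span_def sum.distrib simp flip: sum_distrib_left)
  ultimately show ?thesis unfolding admissible_def by simp
qed

text \<open>
  Let \<open>g\<close> be the greatest common divisor. If \<open>L\<close> is saturated, then it contains the rows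
  \<open>a\<^sub>i b - b\<^sub>i a\<close> of the Pluecker matrix divided by \<open>g\<close>; as \<open>a, b\<close> is a basis, \<open>g\<close> divides all \<open>a\<^sub>i\<close>
  and \<open>b\<^sub>i\<close>, so \<open>g\<^sup>2\<close> divides all entries and thus \<open>g\<close>. Conversely, if \<open>k x = s a + t b\<close>, then wedging
  with \<open>b\<close> and with \<open>a\<close> shows that \<open>k\<close> divides \<open>s\<close> and \<open>t\<close> times each entry, hence divides \<open>s\<close> and \<open>t\<close>
  when \<open>g = 1\<close>.
\<close>
lemma saturated_iff_Gcd:
  assumes ab: "plucker a b \<noteq> 0"
  shows "(\<forall>x. \<forall>k :: nat. k > 0 \<longrightarrow> of_nat k *s x \<in> lattice_span a b \<longrightarrow> x \<in> lattice_span a b) \<longleftrightarrow>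
    Gcd {plucker a b $ i $ j | i j. True} = 1" (is "?sat \<longleftrightarrow> Gcd ?S = 1")
proof
  define g where "g = Gcd ?S"
  have dvd: "g dvd plucker a b $ i $ j" for i j
    unfolding g_def by (rule Gcd_dvd) auto
  obtain i j where "plucker a b $ i $ j \<noteq> 0" using ab by (rule plucker_nonzero_entry)
  then have "g \<noteq> 0" using dvd[of i j] by auto
  then have "g > 0" using Gcd_int_greater_eq_0[of ?S] unfolding g_def by linarith
  assume sat: ?sat
  have ab_dvd: "g dvd a $ i \<and> g dvd b $ i" for i
  proof -
    define x where "x = (\<chi> j. plucker a b $ i $ j div g)"
    have gx: "g *s x = (- b $ i) *s a + (a $ i) *s b"
      using dvd by (simp add: x_def vec_eq_iff) (simp add: plucker_nth algebra_simps)
    then have "of_nat (nat g) *s x \<in> lattice_span a b"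
      using \<open>g > 0\<close> lattice_spanI by simp
    then have "x \<in> lattice_span a b" using sat[rule_format, of "nat g" x] \<open>g > 0\<close> by simp
    then obtain s t where x: "x = s *s a + t *s b" by (auto simp: lattice_span_def)
    have "(- b $ i) *s a + (a $ i) *s b = (g * s) *s a + (g * t) *s b"
      unfolding gx[symmetric] x by (simp add: vec_eq_iff algebra_simps)
    from combination_eqD[OF ab this] show ?thesis by (metis dvd_minus_iff dvd_triv_left)
  qed
  have "g * g dvd g"
    unfolding g_def
  proof (rule Gcd_greatest, fold g_def)
    fix m assume "m \<in> ?S"
    then show "g * g dvd m"
      using ab_dvd by (auto simp: plucker_nth intro!: dvd_diff mult_dvd_mono)
  qed
  then show "Gcd ?S = 1" using \<open>g > 0\<close> unfolding g_def[symmetric] by simp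
next
  assume gcd: "Gcd ?S = 1"
  have cancel: "k dvd c" if "\<And>i j. k dvd c * plucker a b $ i $ j" for k c
  proof -
    have "k dvd Gcd ((*) c ` ?S)"
      using that by (intro Gcd_greatest) auto
    then show ?thesis unfolding Gcd_mult gcd by simp
  qed
  show ?sat
  proof (intro allI impI)
    fix x and k :: nat
    assume k: "k > 0" and "of_nat k *s x \<in> lattice_span a b"
    then obtain s t where st: "of_nat k *s x = s *s a + t *s b" by (auto simp: lattice_span_def)
    have x: "int k * x $ i = s * a $ i + t * b $ i" for i
      using arg_cong[OF st, of "\<lambda>x. x $ i"] by simp
    have "int k dvd s"
    proof (rule cancel)
      fix i j
      have "s * plucker a b $ i $ j = (int k * x $ i) * b $ j - (int k * x $ j) * b $ i"
        unfolding x plucker_nth by (simp add: algebra_simps)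
      then show "int k dvd s * plucker a b $ i $ j"
        by (metis dvd_diff dvd_mult2 dvd_triv_left)
    qed
    moreover have "int k dvd t"
    proof (rule cancel)
      fix i j
      have "t * plucker a b $ i $ j = (int k * x $ j) * a $ i - (int k * x $ i) * a $ j"
        unfolding x plucker_nth by (simp add: algebra_simps)
      then show "int k dvd t * plucker a b $ i $ j"
        by (metis dvd_diff dvd_mult2 dvd_triv_left)
    qed
    ultimately obtain p q where "s = int k * p" "t = int k * q" by (auto elim!: dvdE)
    then have "int k * x $ i = int k * (p * a $ i + q * b $ i)" for i
      unfolding x by (simp add: algebra_simps)
    then have "x = p *s a + q *s b" using k by (simp add: vec_eq_iff)
    then show "x \<in> lattice_span a b" by (metis lattice_spanI)
  qed
qed

text \<open>
  The equations express \<open>x \<and> a \<and> b = 0\<close>. They define the saturation of the lattice: at a nonzero entry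
  \<open>p\<close> of the Pluecker matrix they exhibit \<open>p x\<close> as an element of the lattice.
\<close>
lemma saturated_lattice_span_eq:
  assumes ab: "plucker a b \<noteq> 0"
    and sat: "\<And>x k. (k :: nat) > 0 \<Longrightarrow> of_nat k *s x \<in> lattice_span a b \<Longrightarrow> x \<in> lattice_span a b"
  shows "lattice_span a b =
    {x. \<forall>i j k. x $ i * plucker a b $ j $ k - x $ j * plucker a b $ i $ k + x $ k * plucker a b $ i $ j = 0}"
    (is "_ = ?V")
proof
  show "lattice_span a b \<subseteq> ?V"
    by (auto simp: lattice_span_def plucker_nth algebra_simps)
  show "?V \<subseteq> lattice_span a b"
  proof
    fix x assume "x \<in> ?V"
    then have V: "x $ i * plucker a b $ j $ k - x $ j * plucker a b $ i $ k + x $ k * plucker a b $ i $ j = 0"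
      for i j k by simp
    obtain i j where m: "plucker a b $ i $ j \<noteq> 0" using ab by (rule plucker_nonzero_entry)
    define p where "p = plucker a b $ i $ j"
    have "p *s x = (x $ i * b $ j - x $ j * b $ i) *s a + (x $ j * a $ i - x $ i * a $ j) *s b"
    proof -
      have "p * x $ k = (x $ i * b $ j - x $ j * b $ i) * a $ k + (x $ j * a $ i - x $ i * a $ j) * b $ k" for k
        using V[of i j k] unfolding p_def plucker_nth by (simp add: algebra_simps)
      then show ?thesis
        unfolding vec_eq_iff vector_add_component vector_smult_component by blast
    qed
    then have "p *s x \<in> lattice_span a b" by (simp only: lattice_spanI)
    from lattice_span_scale[OF this, of "sgn p"] have "(sgn p * p) *s x \<in> lattice_span a b"
      by simp
    moreover have "sgn p * p = of_nat (nat \<bar>p\<bar>)" by (simp add: sgn_if)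
    ultimately have "of_nat (nat \<bar>p\<bar>) *s x \<in> lattice_span a b" by metis
    then show "x \<in> lattice_span a b" using sat[of "nat \<bar>p\<bar>" x] m by (simp add: p_def)
  qed
qed

section \<open>The correspondence between lattices and quivers\<close>

lemma oriented_basis_of_admissible:
  assumes "admissible L" "\<omega> \<in> orientations L"
  obtains a b where "oriented_basis L \<omega> a b" "no_short_loops (plucker_quiver L \<omega>)"
    "antisym_adjacency (plucker_quiver L \<omega>) = plucker a b"
proof -
  obtain a b where ab: "oriented_basis L \<omega> a b"
    using assms oriented_basis_exists unfolding admissible_def by blast
  have "plucker_matrix L \<omega> = plucker a b" using assms(2) ab by (rule plucker_matrix_eq)
  then show ?thesis
    using that ab plucker_quiver_eq_iff[of L \<omega> "plucker_quiver L \<omega>"] antisymmetric_plucker by metis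
qed

lemma good_plucker_quiver:
  fixes L :: "(int ^ 'n::finite) set"
  assumes "admissible L" "\<omega> \<in> orientations L"
  shows "good_quiver (plucker_quiver L \<omega>)"
proof -
  obtain a b where ob: "oriented_basis L \<omega> a b" and Q: "no_short_loops (plucker_quiver L \<omega>)"
    "antisym_adjacency (plucker_quiver L \<omega>) = plucker a b"
    using assms by (rule oriented_basis_of_admissible)
  note L = oriented_basisD(1)[OF ob] and ab = oriented_basisD(2)[OF ob]
  have adm: "\<forall>i. plucker a b $ i \<noteq> 0" "(\<Sum>j\<in>UNIV. a $ j) = 0" "(\<Sum>j\<in>UNIV. b $ j) = 0"
    using assms(1) unfolding L admissible_lattice_span_iff[OF ab] by auto
  have "(\<Sum>j\<in>UNIV. plucker a b $ i $ j) = a $ i * (\<Sum>j\<in>UNIV. b $ j) - b $ i * (\<Sum>j\<in>UNIV. a $ j)" for i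
    by (simp add: plucker_nth sum_subtractf sum_distrib_left mult.commute)
  then show ?thesis
    unfolding good_quiver_iff Q(2) using adm Q(1) rank_plucker[OF ab] by simp
qed

lemma plucker_quiver_of_good_quiver:
  fixes Q :: "'n::finite quiver"
  assumes "good_quiver Q"
  obtains L \<omega> where "admissible L" "\<omega> \<in> orientations L" "Q = plucker_quiver L \<omega>"
proof -
  define M where "M = antisym_adjacency Q"
  have anti: "antisymmetric M" unfolding M_def by (rule antisymmetric_antisym_adjacency)
  have Q: "no_short_loops Q" and rows: "\<And>i. M $ i \<noteq> 0" and zero: "\<And>i. (\<Sum>j\<in>UNIV. M $ i $ j) = 0"
    and rank: "rank (map_matrix real_of_int M) = 2"
    using assms unfolding good_quiver_iff M_def by auto
  have "M \<noteq> 0" using rows by auto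
  obtain a b where M: "M = plucker a b" and sums: "(\<Sum>j\<in>UNIV. a $ j) = 0" "(\<Sum>j\<in>UNIV. b $ j) = 0"
    using decomposable[OF anti relations_of_rank_two[OF anti rank] \<open>M \<noteq> 0\<close> zero] by blast
  have ab: "plucker a b \<noteq> 0" using \<open>M \<noteq> 0\<close> M by simp
  define L where "L = lattice_span a b"
  obtain \<omega> where \<omega>: "\<omega> \<in> orientations L" "\<omega> (wedge L a b) = 1"
    using orientation_exists[OF L_def ab] by blast
  have "admissible L"
    unfolding L_def admissible_lattice_span_iff[OF ab] using rows sums M by simp
  moreover have "plucker_matrix L \<omega> = M"
    using \<omega> ab plucker_matrix_eq[of \<omega> L a b] by (simp add: oriented_basis_def L_def M)
  then have "plucker_quiver L \<omega> = Q"
    using plucker_quiver_eq_iff[of L \<omega> Q] anti Q by (simp add: M_def)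
  ultimately show ?thesis using \<omega> that by blast
qed

lemma torsion_free_iff_entries_gcd:
  fixes L :: "(int ^ 'n::finite) set"
  assumes "admissible L" "\<omega> \<in> orientations L"
  shows "torsion_free (lattice_group Mod L) \<longleftrightarrow> entries_gcd (plucker_quiver L \<omega>) = 1"
proof -
  obtain a b where ob: "oriented_basis L \<omega> a b"
    and Q: "antisym_adjacency (plucker_quiver L \<omega>) = plucker a b"
    using assms by (rule oriented_basis_of_admissible)
  note L = oriented_basisD(1)[OF ob] and ab = oriented_basisD(2)[OF ob]
  have "torsion_free (lattice_group Mod L) \<longleftrightarrow> Gcd {plucker a b $ i $ j | i j. True} = 1"
    unfolding L saturated_iff_Gcd[OF ab, symmetric]
    by (rule torsion_free_Mod_iff[OF subgroup_lattice_span])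
  then show ?thesis by (simp only: entries_gcd_def Q)
qed

text \<open>
  The common Pluecker matrix determines the saturated lattice by \<open>saturated_lattice_span_eq\<close>. Two oriented
  bases with the same nonzero Pluecker matrix differ by a base change of determinant 1, so both
  orientations take the value 1 at the second basis.
\<close>
lemma plucker_quiver_inj:
  fixes L L' :: "(int ^ 'n::finite) set"
  assumes L: "admissible L" "\<omega> \<in> orientations L" "torsion_free (lattice_group Mod L)"
    and L': "admissible L'" "\<omega>' \<in> orientations L'" "torsion_free (lattice_group Mod L')"
    and eq: "plucker_quiver L \<omega> = plucker_quiver L' \<omega>'"
  shows "L = L' \<and> \<omega> = \<omega>'"
proof -
  obtain a b where ob: "oriented_basis L \<omega> a b"
    and Q: "antisym_adjacency (plucker_quiver L \<omega>) = plucker a b"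
    using L(1,2) by (rule oriented_basis_of_admissible)
  obtain c d where ob': "oriented_basis L' \<omega>' c d"
    and Q': "antisym_adjacency (plucker_quiver L' \<omega>') = plucker c d"
    using L'(1,2) by (rule oriented_basis_of_admissible)
  have pl: "plucker c d = plucker a b" using Q Q' eq by simp
  note sp = oriented_basisD[OF ob] oriented_basisD[OF ob']
  have "lattice_span a b = {x. \<forall>i j k. x $ i * plucker a b $ j $ k - x $ j * plucker a b $ i $ k +
      x $ k * plucker a b $ i $ j = 0}"
    using L(3) unfolding sp(1) torsion_free_Mod_iff[OF subgroup_lattice_span]
    by (intro saturated_lattice_span_eq sp) blast
  moreover have "lattice_span c d = {x. \<forall>i j k. x $ i * plucker c d $ j $ k - x $ j * plucker c d $ i $ k +
      x $ k * plucker c d $ i $ j = 0}"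
    using L'(3) unfolding sp(4) torsion_free_Mod_iff[OF subgroup_lattice_span]
    by (intro saturated_lattice_span_eq sp) blast
  ultimately have LL: "L = L'" using sp pl by simp
  have "c \<in> L" "d \<in> L" unfolding LL sp(4) by (rule generators_in_lattice_span)+
  then obtain s t s' t' where cd: "c = s *s a + t *s b" "d = s' *s a + t' *s b"
    unfolding sp(1) lattice_span_def by auto
  obtain i j where m: "plucker a b $ i $ j \<noteq> 0" using sp(2) by (rule plucker_nonzero_entry)
  have det: "s * t' - t * s' = 1"
    using plucker_combination[of s a t b s' t' i j] pl m unfolding cd by simp
  have "\<omega> (wedge L c d) = (s * t' - t * s') * \<omega> (wedge L a b)"
    unfolding cd by (rule hom_exterior_square_wedge[OF sp(1) orientation_hom[OF sp(1) L(2)]])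
  then have "\<omega> (wedge L c d) = \<omega>' (wedge L c d)" using det sp LL by simp
  then have "\<omega> = \<omega>'"
    using orientation_eqI[of L c d \<omega> \<omega>'] LL sp L(2) L'(2) by simp
  with LL show ?thesis by simp
qed

theorem theorem2p10:
  shows
    "(\<forall>(L :: (int ^ 'n::finite) set) \<omega>.
        admissible L \<and> \<omega> \<in> orientations L \<longrightarrow> good_quiver (plucker_quiver L \<omega>)) \<and>
     (\<forall>Q :: 'n quiver. good_quiver Q \<longrightarrow>
        (\<exists>L \<omega>. admissible L \<and> \<omega> \<in> orientations L \<and> Q = plucker_quiver L \<omega>)) \<and>
     bij_betw (\<lambda>(L, \<omega>). plucker_quiver L \<omega>)
       {(L :: (int ^ 'n) set, \<omega>). admissible L \<and> \<omega> \<in> orientations L \<and>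
          torsion_free (lattice_group Mod L)}
       {Q :: 'n quiver. good_quiver Q \<and> entries_gcd Q = 1}"
    (is "?good \<and> ?onto \<and> bij_betw ?f ?P ?R")
proof (intro conjI)
  show ?good using good_plucker_quiver by blast
  show onto: ?onto using plucker_quiver_of_good_quiver by metis
  show "bij_betw ?f ?P ?R"
    unfolding bij_betw_def
  proof
    show "inj_on ?f ?P"
      by (rule inj_onI) (auto dest: plucker_quiver_inj)
    show "?f ` ?P = ?R"
    proof
      show "?f ` ?P \<subseteq> ?R"
        using good_plucker_quiver torsion_free_iff_entries_gcd by auto
      show "?R \<subseteq> ?f ` ?P"
      proof
        fix Q assume "Q \<in> ?R"
        then obtain L \<omega> where "admissible L" "\<omega> \<in> orientations L" "Q = plucker_quiver L \<omega>"
          and "entries_gcd Q = 1"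
          using plucker_quiver_of_good_quiver by blast
        then have "(L, \<omega>) \<in> ?P" "Q = ?f (L, \<omega>)"
          using torsion_free_iff_entries_gcd by auto
        then show "Q \<in> ?f ` ?P" by (rule rev_image_eqI)
      qed
    qed
  qed
qed

end
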